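(* Let $D$ be a smooth connected Riemannian manifold with Dirichlet heat kernel $p(x,y;t)$, and let $\psi_1,\psi_2: D\to[0,\infty)$ be non-negative Borel measurable functions. For non-negative measurable $f,g$ on $D$ and $t>0$ put $Q_{f,g}(t)=\iint_{D\times D}p(x,y;t)f(x)g(y)\,dx\,dy\in[0,\infty]$. (i) If $Q_{\psi_i,\psi_i}(t)<\infty$ for $i=1,2$ and all $t>0$, then $Q_{\psi_1,\psi_2}(t)<\infty$ for all $t>0$, and $$Q_{\psi_1,\psi_2}(t)\le \left(Q_{\psi_1,\psi_1}(t)\,Q_{\psi_2,\psi_2}(t)\right)^{1/2},\qquad t>0.$$ (ii) If $Q_{\psi_i,1}(t)<\infty$ for $i=1,2$ and all $t>0$, and if $$c_t:=\sup_{x\in D}p(x,x;t)<\infty,\qquad t>0,$$ then $$Q_{\psi_1,\psi_2}(t)\le c_{t/3}\,Q_{\psi_1,1}(t/3)\,Q_{\psi_2,1}(t/3)<\infty,\qquad t>0.$$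
   Context: $\Delta$ is the Laplace-Beltrami operator on $D$ and $dx$ denotes the Riemannian measure. The Dirichlet heat kernel $p(x,y;t)$, $x,y\in D$, $t>0$, is the unique minimal positive fundamental solution of the heat equation $\Delta u=\partial u/\partial t$ on $D$; it is symmetric in $x,y$, strictly positive, jointly smooth, and satisfies the semigroup property $p(x,y;s+t)=\int_D p(x,z;s)p(z,y;t)\,dz$ for all $s,t>0$. In $Q_{\psi_i,1}$ the symbol $1$ denotes the constant function equal to $1$ on $D$. *)

theory Defs
  imports "HOL-Analysis.Analysis"
begin

text \<open>Only used for open sets S; smoothness is then the usual C-infinity on S.\<close>

primrec Ck_on :: "nat \<Rightarrow> ('b::real_normed_vector \<Rightarrow> 'c::real_normed_vector) \<Rightarrow> 'b set \<Rightarrow> bool" where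
  "Ck_on 0 f S \<longleftrightarrow> continuous_on S f"
| "Ck_on (Suc k) f S \<longleftrightarrow>
     (\<forall>x\<in>S. f differentiable (at x)) \<and> (\<forall>v. Ck_on k (\<lambda>x. frechet_derivative f (at x) v) S)"

definition smooth_on :: "'b set \<Rightarrow> ('b::real_normed_vector \<Rightarrow> 'c::real_normed_vector) \<Rightarrow> bool" where
  "smooth_on S f \<longleftrightarrow> (\<forall>k. Ck_on k f S)"

text \<open>
  A manifold is a subset D of a second countable Hausdorff type, with the subspace topology,
  together with an atlas.  A chart is a pair of its domain and its coordinate map, the latter
  being relevant only on the domain.
\<close>

type_synonym ('a, 'n) chart = "'a set \<times> ('a \<Rightarrow> real ^ 'n)"

abbreviation chart_image :: "('a, 'n::finite) chart \<Rightarrow> (real ^ 'n) set" where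
  "chart_image c \<equiv> snd c ` fst c"

abbreviation chart_inv :: "('a, 'n::finite) chart \<Rightarrow> real ^ 'n \<Rightarrow> 'a" where
  "chart_inv c \<equiv> inv_into (fst c) (snd c)"

definition is_chart :: "'a::topological_space set \<Rightarrow> ('a, 'n::finite) chart \<Rightarrow> bool" where
  "is_chart D c \<longleftrightarrow>
     openin (top_of_set D) (fst c) \<and> open (chart_image c) \<and>
     homeomorphism (fst c) (chart_image c) (snd c) (chart_inv c)"

definition smooth_manifold ::
  "'a::{t2_space, second_countable_topology} set \<Rightarrow> ('a, 'n::finite) chart set \<Rightarrow> bool" where
  "smooth_manifold D A \<longleftrightarrow>
     (\<forall>c\<in>A. is_chart D c) \<and> (\<Union>c\<in>A. fst c) = D \<and>
     (\<forall>c\<in>A. \<forall>c'\<in>A. smooth_on (snd c ` (fst c \<inter> fst c')) (snd c' \<circ> chart_inv c))"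

text \<open>
  A metric tensor is given by its component matrices: \<open>g c x $ i $ j\<close> is the inner product of
  the i-th and j-th coordinate vectors of the chart c at the point x.  The last condition below
  is the transformation law of a covariant 2-tensor.
\<close>

type_synonym ('a, 'n) metric_tensor = "('a, 'n) chart \<Rightarrow> 'a \<Rightarrow> real ^ 'n ^ 'n"

definition transition_jacobian ::
  "('a, 'n::finite) chart \<Rightarrow> ('a, 'n) chart \<Rightarrow> 'a \<Rightarrow> real ^ 'n ^ 'n" where
  "transition_jacobian c c' x = matrix (frechet_derivative (snd c' \<circ> chart_inv c) (at (snd c x)))"

definition riemannian_metric ::
  "('a, 'n::finite) chart set \<Rightarrow> ('a, 'n) metric_tensor \<Rightarrow> bool" where
  "riemannian_metric A g \<longleftrightarrow>
     (\<forall>c\<in>A. \<forall>i j. smooth_on (chart_image c) (\<lambda>z. g c (chart_inv c z) $ i $ j)) \<and>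
     (\<forall>c\<in>A. \<forall>x\<in>fst c. transpose (g c x) = g c x) \<and>
     (\<forall>c\<in>A. \<forall>x\<in>fst c. \<forall>v. v \<noteq> 0 \<longrightarrow> v \<bullet> (g c x *v v) > 0) \<and>
     (\<forall>c\<in>A. \<forall>c'\<in>A. \<forall>x\<in>fst c \<inter> fst c'.
        g c x = transpose (transition_jacobian c c' x) ** g c' x ** transition_jacobian c c' x)"

definition volume_density ::
  "('a, 'n::finite) metric_tensor \<Rightarrow> ('a, 'n) chart \<Rightarrow> 'a \<Rightarrow> real" where
  "volume_density g c x = sqrt (det (g c x))"

text \<open>
  The chart domains have a countable subcover of D, so at most one measure satisfies the
  following condition.
\<close>

definition riemannian_measure ::
  "'a::topological_space set \<Rightarrow> ('a, 'n::finite) chart set \<Rightarrow> ('a, 'n) metric_tensor \<Rightarrow>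
   'a measure \<Rightarrow> bool" where
  "riemannian_measure D A g M \<longleftrightarrow>
     sets M = sets (restrict_space borel D) \<and>
     (\<forall>c\<in>A. \<forall>B\<in>sets M. B \<subseteq> fst c \<longrightarrow>
        emeasure M B =
          (\<integral>\<^sup>+z\<in>snd c ` B. ennreal (volume_density g c (chart_inv c z)) \<partial>lborel))"

definition coord_deriv :: "'n::finite \<Rightarrow> (real ^ 'n \<Rightarrow> real) \<Rightarrow> real ^ 'n \<Rightarrow> real" where
  "coord_deriv i h z = frechet_derivative h (at z) (axis i 1)"

text \<open>The coordinate expression \<open>(1/\<rho>) \<Sum>\<^sub>i \<partial>\<^sub>i (\<rho> \<Sum>\<^sub>j g\<^sup>i\<^sup>j \<partial>\<^sub>j u)\<close>, where \<open>\<rho> = sqrt (det g)\<close>.\<close>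

definition chart_laplacian ::
  "('a, 'n::finite) metric_tensor \<Rightarrow> ('a, 'n) chart \<Rightarrow> ('a \<Rightarrow> real) \<Rightarrow> 'a \<Rightarrow> real" where
  "chart_laplacian g c u x =
     (\<Sum>i\<in>UNIV. coord_deriv i
        (\<lambda>z. volume_density g c (chart_inv c z) *
              (\<Sum>j\<in>UNIV. matrix_inv (g c (chart_inv c z)) $ i $ j *
                 coord_deriv j (u \<circ> chart_inv c) z))
        (snd c x)) / volume_density g c x"

text \<open>For smooth u the value does not depend on the chart chosen around x.\<close>

definition laplace_beltrami ::
  "('a, 'n::finite) chart set \<Rightarrow> ('a, 'n) metric_tensor \<Rightarrow> ('a \<Rightarrow> real) \<Rightarrow> 'a \<Rightarrow> real" where
  "laplace_beltrami A g u x = chart_laplacian g (SOME c. c \<in> A \<and> x \<in> fst c) u x"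

definition heat_solution ::
  "'a set \<Rightarrow> ('a, 'n::finite) chart set \<Rightarrow> ('a, 'n) metric_tensor \<Rightarrow>
   ('a \<Rightarrow> real \<Rightarrow> real) \<Rightarrow> bool" where
  "heat_solution D A g u \<longleftrightarrow>
     (\<forall>c\<in>A. smooth_on (chart_image c \<times> {0<..}) (\<lambda>(z, t). u (chart_inv c z) t)) \<and>
     (\<forall>x\<in>D. \<forall>t>0. (u x has_real_derivative laplace_beltrami A g (\<lambda>x. u x t) x) (at t))"

text \<open>The initial condition says that \<open>u(\<cdot>, t) dx\<close> converges vaguely to the Dirac measure at y.\<close>

definition fundamental_solution_at ::
  "'a::topological_space set \<Rightarrow> ('a, 'n::finite) chart set \<Rightarrow> ('a, 'n) metric_tensor \<Rightarrow>
   'a measure \<Rightarrow> 'a \<Rightarrow> ('a \<Rightarrow> real \<Rightarrow> real) \<Rightarrow> bool" where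
  "fundamental_solution_at D A g M y u \<longleftrightarrow>
     heat_solution D A g u \<and>
     (\<forall>f :: 'a \<Rightarrow> real. \<forall>K. continuous_on D f \<and> compact K \<and> K \<subseteq> D \<and> (\<forall>x\<in>D - K. f x = 0) \<longrightarrow>
        ((\<lambda>t. \<integral>x. u x t * f x \<partial>M) \<longlongrightarrow> f y) (at_right 0))"

definition dirichlet_heat_kernel ::
  "'a::topological_space set \<Rightarrow> ('a, 'n::finite) chart set \<Rightarrow> ('a, 'n) metric_tensor \<Rightarrow>
   'a measure \<Rightarrow> ('a \<Rightarrow> 'a \<Rightarrow> real \<Rightarrow> real) \<Rightarrow> bool" where
  "dirichlet_heat_kernel D A g M p \<longleftrightarrow>
     (\<forall>y\<in>D. fundamental_solution_at D A g M y (\<lambda>x. p x y) \<and>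
        (\<forall>x\<in>D. \<forall>t>0. 0 \<le> p x y t) \<and>
        (\<forall>u. fundamental_solution_at D A g M y u \<and> (\<forall>x\<in>D. \<forall>t>0. 0 \<le> u x t) \<longrightarrow>
           (\<forall>x\<in>D. \<forall>t>0. p x y t \<le> u x t)))"

definition jointly_smooth ::
  "('a, 'n::finite) chart set \<Rightarrow> ('a \<Rightarrow> 'a \<Rightarrow> real \<Rightarrow> real) \<Rightarrow> bool" where
  "jointly_smooth A p \<longleftrightarrow>
     (\<forall>c\<in>A. \<forall>c'\<in>A. smooth_on (chart_image c \<times> chart_image c' \<times> {0<..})
        (\<lambda>(z, w, t). p (chart_inv c z) (chart_inv c' w) t))"

definition heat_content ::
  "'a measure \<Rightarrow> ('a \<Rightarrow> 'a \<Rightarrow> real \<Rightarrow> real) \<Rightarrow> ('a \<Rightarrow> real) \<Rightarrow> ('a \<Rightarrow> real) \<Rightarrow> real \<Rightarrow> ennreal" where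
  "heat_content M p f g t = (\<integral>\<^sup>+(x, y). ennreal (p x y t * f x * g y) \<partial>(M \<Otimes>\<^sub>M M))"

definition diagonal_sup ::
  "'a set \<Rightarrow> ('a \<Rightarrow> 'a \<Rightarrow> real \<Rightarrow> real) \<Rightarrow> real \<Rightarrow> ennreal" where
  "diagonal_sup D p t = (SUP x\<in>D. ennreal (p x x t))"

end

theory Submission
  imports Defs
begin

text \<open>
  Write \<open>P\<^sub>t f (x) = \<integral> p(x, y; t) f(y) dy\<close>.  The semigroup property and the symmetry of \<open>p\<close> say
  that \<open>P\<^sub>s P\<^sub>t = P\<^bsub>s+t\<^esub>\<close> and that every \<open>P\<^sub>t\<close> is self-adjoint, so part of the time can be moved
  from one argument of the heat content to the other (lemma \<open>form_add\<close>):
  \<open>Q\<^sub>f\<^sub>,\<^sub>g(s + t) = \<integral> P\<^sub>s f \<cdot> P\<^sub>t g\<close>.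

  For (i), take \<open>s = t\<close>: the heat content at time \<open>2t\<close> is the \<open>L\<^sup>2\<close> inner product of \<open>P\<^sub>t f\<close>
  and \<open>P\<^sub>t g\<close>, and the claim is the Cauchy-Schwarz inequality.  For (ii), the same argument for
  the kernel itself gives \<open>p(x, y; t)\<^sup>2 \<le> p(x, x; t) p(y, y; t)\<close>, so that \<open>p(\<cdot>, \<cdot>; t) \<le> c\<^sub>t\<close> on
  \<open>D \<times> D\<close>.  At time \<open>3t\<close> the heat content of \<open>f, g\<close> is the integral of
  \<open>P\<^sub>t f(z) p(z, w; t) P\<^sub>t g(w)\<close> over \<open>z\<close> and \<open>w\<close>; bounding the middle factor by \<open>c\<^sub>t\<close> separates
  the variables, and \<open>\<integral> P\<^sub>t f = Q\<^sub>f\<^sub>,\<^sub>1(t)\<close>.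

  Both arguments concern an abstract symmetric kernel with values in \<open>[0, \<infinity>]\<close> on a sigma-finite
  measure space, and Tonelli's theorem justifies every exchange of integrals.  The geometry
  enters only through the two hypotheses of that theorem: the Riemannian measure is
  sigma-finite, because countably many charts cover \<open>D\<close> and the volume density is locally
  bounded, and the heat kernel is measurable for the product sigma-algebra, because it is
  continuous on \<open>D \<times> D\<close> and the topology is second countable.
\<close>

section \<open>Symmetric semigroups of kernels\<close>

lemma ennreal_le_of_power2_le:
  fixes a b :: ennreal
  assumes "a\<^sup>2 \<le> b\<^sup>2"
  shows "a \<le> b"
proof (cases b)
  case (real s)
  then have "a < top"
    using assms power_less_top_ennreal[of a 2] power_less_top_ennreal[of b 2]
    by (auto simp: less_top[symmetric] top_unique)
  then obtain r where r: "0 \<le> r" "a = ennreal r"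
    by (cases a) auto
  have "ennreal (r\<^sup>2) \<le> ennreal (s\<^sup>2)"
    using assms unfolding r(2) real(2) ennreal_power[OF r(1)] ennreal_power[OF real(1)] .
  then have "r \<le> s"
    using power2_le_imp_le[OF _ real(1)] by (metis ennreal_le_iff zero_le_power2)
  then show ?thesis
    unfolding r(2) real(2) by (rule ennreal_leI)
qed simp

text \<open>
  Values in \<open>[0, \<infinity>]\<close> keep the algebra free of integrability side conditions; identities are
  required only on the space of \<open>M\<close>, which for the heat kernel is the manifold.
\<close>

locale symmetric_kernel_semigroup = sigma_finite_measure M for M :: "'a measure" +
  fixes k :: "real \<Rightarrow> 'a \<Rightarrow> 'a \<Rightarrow> ennreal"
  assumes measurable_kernel: "t > 0 \<Longrightarrow> (\<lambda>(x, y). k t x y) \<in> borel_measurable (M \<Otimes>\<^sub>M M)"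
    and kernel_sym: "x \<in> space M \<Longrightarrow> y \<in> space M \<Longrightarrow> t > 0 \<Longrightarrow> k t x y = k t y x"
    and chapman_kolmogorov: "x \<in> space M \<Longrightarrow> y \<in> space M \<Longrightarrow> s > 0 \<Longrightarrow> t > 0 \<Longrightarrow>
          k (s + t) x y = (\<integral>\<^sup>+z. k s x z * k t z y \<partial>M)"
begin

definition semigroup_op :: "real \<Rightarrow> ('a \<Rightarrow> ennreal) \<Rightarrow> 'a \<Rightarrow> ennreal" where
  "semigroup_op t f x = (\<integral>\<^sup>+y. k t x y * f y \<partial>M)"

definition form :: "real \<Rightarrow> ('a \<Rightarrow> ennreal) \<Rightarrow> ('a \<Rightarrow> ennreal) \<Rightarrow> ennreal" where
  "form t f g = (\<integral>\<^sup>+x. f x * semigroup_op t g x \<partial>M)"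

lemma pair_sigma_finite_self: "pair_sigma_finite M M"
  by (intro pair_sigma_finite.intro sigma_finite_measure_axioms)

lemma measurable_kernel_compose:
  assumes "t > 0" "u \<in> N \<rightarrow>\<^sub>M M" "v \<in> N \<rightarrow>\<^sub>M M"
  shows "(\<lambda>z. k t (u z) (v z)) \<in> borel_measurable N"
  using measurable_compose[OF measurable_Pair[OF assms(2,3)] measurable_kernel[OF assms(1)]] by simp

lemma measurable_semigroup_op:
  assumes "t > 0" and [measurable]: "f \<in> borel_measurable M"
  shows "semigroup_op t f \<in> borel_measurable M"
proof -
  note [measurable (raw)] = measurable_kernel_compose[OF \<open>t > 0\<close>]
  show ?thesis
    unfolding semigroup_op_def by measurable
qed

text \<open>
  The operators are self-adjoint: exchange the integrals and use the symmetry of the kernel.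
\<close>

lemma form_sym:
  assumes t: "t > 0" and f [measurable]: "f \<in> borel_measurable M"
    and g [measurable]: "g \<in> borel_measurable M"
  shows "form t f g = form t g f"
proof -
  note [measurable (raw)] = measurable_kernel_compose[OF t]
  have "form t f g = (\<integral>\<^sup>+x. \<integral>\<^sup>+y. f x * (k t x y * g y) \<partial>M \<partial>M)"
    unfolding form_def semigroup_op_def by (intro nn_integral_cong nn_integral_cmult[symmetric]) measurable
  also have "\<dots> = (\<integral>\<^sup>+y. \<integral>\<^sup>+x. f x * (k t x y * g y) \<partial>M \<partial>M)"
    by (rule pair_sigma_finite.Fubini'[OF pair_sigma_finite_self, symmetric]) measurable
  also have "\<dots> = (\<integral>\<^sup>+y. \<integral>\<^sup>+x. g y * (k t y x * f x) \<partial>M \<partial>M)"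
    by (intro nn_integral_cong) (simp add: kernel_sym[OF _ _ t] mult_ac)
  also have "\<dots> = form t g f"
    unfolding form_def semigroup_op_def by (intro nn_integral_cong nn_integral_cmult) measurable
  finally show ?thesis .
qed

lemma semigroup_op_add:
  assumes s: "s > 0" and t: "t > 0" and x: "x \<in> space M" and f [measurable]: "f \<in> borel_measurable M"
  shows "semigroup_op (s + t) f x = semigroup_op s (semigroup_op t f) x"
proof -
  note [measurable (raw)] = measurable_kernel_compose[OF s] measurable_kernel_compose[OF t]
  note [measurable] = x
  have "semigroup_op (s + t) f x = (\<integral>\<^sup>+y. (\<integral>\<^sup>+z. k s x z * k t z y \<partial>M) * f y \<partial>M)"
    unfolding semigroup_op_def by (intro nn_integral_cong) (simp add: chapman_kolmogorov x s t)
  also have "\<dots> = (\<integral>\<^sup>+y. \<integral>\<^sup>+z. k s x z * k t z y * f y \<partial>M \<partial>M)"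
    by (intro nn_integral_cong nn_integral_multc[symmetric]) measurable
  also have "\<dots> = (\<integral>\<^sup>+z. \<integral>\<^sup>+y. k s x z * k t z y * f y \<partial>M \<partial>M)"
    by (rule pair_sigma_finite.Fubini'[OF pair_sigma_finite_self]) measurable
  also have "\<dots> = semigroup_op s (semigroup_op t f) x"
    unfolding semigroup_op_def mult.assoc by (intro nn_integral_cong nn_integral_cmult) measurable
  finally show ?thesis .
qed

text \<open>
  Splitting off the time \<open>s\<close> by the semigroup law and moving \<open>P\<^sub>s\<close> to the other argument by
  self-adjointness.
\<close>

lemma form_add:
  assumes s: "s > 0" and t: "t > 0" and f [measurable]: "f \<in> borel_measurable M"
    and g [measurable]: "g \<in> borel_measurable M"
  shows "form (s + t) f g = (\<integral>\<^sup>+z. semigroup_op s f z * semigroup_op t g z \<partial>M)"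
proof -
  have "form (s + t) f g = form s f (semigroup_op t g)"
    unfolding form_def by (intro nn_integral_cong) (simp add: semigroup_op_add s t g)
  also have "\<dots> = form s (semigroup_op t g) f"
    by (intro form_sym s f measurable_semigroup_op t g)
  finally show ?thesis
    by (simp add: form_def mult.commute)
qed

text \<open>
  Halving the time makes the form an \<open>L\<^sup>2\<close> inner product.  The squared inequality is meaningful
  with infinite values as well.
\<close>

lemma form_Cauchy_Schwarz:
  assumes t: "t > 0" and f: "f \<in> borel_measurable M" and g: "g \<in> borel_measurable M"
  shows "(form t f g)\<^sup>2 \<le> form t f f * form t g g"
proof -
  have *: "t / 2 > 0"
    using t by simp
  have split: "form t u v = (\<integral>\<^sup>+z. semigroup_op (t/2) u z * semigroup_op (t/2) v z \<partial>M)"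
    if "u \<in> borel_measurable M" "v \<in> borel_measurable M" for u v
    using form_add[OF * * that] by simp
  show ?thesis
    unfolding split[OF f g] split[OF f f] split[OF g g]
    using Cauchy_Schwarz_nn_integral[OF measurable_semigroup_op[OF * f] measurable_semigroup_op[OF * g]]
    by (simp add: power2_eq_square)
qed

text \<open>
  The kernel at time \<open>t\<close> is the inner product of its sections \<open>k (t/2) x\<close> and \<open>k (t/2) y\<close>, whose
  squared norms are the diagonal values at time \<open>t\<close>.
\<close>

lemma kernel_le_diagonal:
  assumes t: "t > 0" and x: "x \<in> space M" and y: "y \<in> space M"
    and diag: "\<And>z. z \<in> space M \<Longrightarrow> k t z z \<le> c"
  shows "k t x y \<le> c"
proof -
  have *: "t / 2 > 0"
    using t by simp
  note [measurable (raw)] = measurable_kernel_compose[OF *]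
  note [measurable] = x y
  have split: "k t u v = (\<integral>\<^sup>+z. k (t/2) u z * k (t/2) v z \<partial>M)"
    if "u \<in> space M" "v \<in> space M" for u v
  proof -
    have "k t u v = (\<integral>\<^sup>+z. k (t/2) u z * k (t/2) z v \<partial>M)"
      using chapman_kolmogorov[OF that * *] by simp
    also have "\<dots> = (\<integral>\<^sup>+z. k (t/2) u z * k (t/2) v z \<partial>M)"
      by (intro nn_integral_cong) (simp add: kernel_sym[OF _ that(2) *])
    finally show ?thesis .
  qed
  have "(k t x y)\<^sup>2 \<le> k t x x * k t y y"
    unfolding split[OF x y] split[OF x x] split[OF y y]
    using Cauchy_Schwarz_nn_integral[of "k (t/2) x" M "k (t/2) y"] by (simp add: power2_eq_square)
  also have "\<dots> \<le> c\<^sup>2"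
    unfolding power2_eq_square by (intro mult_mono diag x y) auto
  finally show ?thesis
    by (rule ennreal_le_of_power2_le)
qed

text \<open>
  Of the three factors into which the kernel at time \<open>3t\<close> splits, the outer two act on \<open>f\<close> and
  \<open>g\<close>, and the middle one is replaced by its bound \<open>c\<close>.
\<close>

lemma form_le_of_diagonal:
  assumes t: "t > 0" and f: "f \<in> borel_measurable M" and g: "g \<in> borel_measurable M"
    and diag: "\<And>z. z \<in> space M \<Longrightarrow> k t z z \<le> c"
  shows "form (t + (t + t)) f g \<le> c * form t f (\<lambda>_. 1) * form t g (\<lambda>_. 1)"
proof -
  \<comment> \<open>Self-adjointness moves the operator from the constant 1 to u.\<close>
  have mass: "form t u (\<lambda>_. 1) = (\<integral>\<^sup>+z. semigroup_op t u z \<partial>M)" if "u \<in> borel_measurable M" for u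
  proof -
    have "form t u (\<lambda>_. 1) = form t (\<lambda>_. 1) u"
      by (intro form_sym t that borel_measurable_const)
    then show ?thesis
      unfolding form_def by simp
  qed
  have bound: "semigroup_op t (semigroup_op t g) z \<le> c * form t g (\<lambda>_. 1)" if "z \<in> space M" for z
  proof -
    have "semigroup_op t (semigroup_op t g) z \<le> (\<integral>\<^sup>+w. c * semigroup_op t g w \<partial>M)"
      unfolding semigroup_op_def[of t "semigroup_op t g"]
      by (intro nn_integral_mono mult_right_mono kernel_le_diagonal[OF t that]) (auto intro: diag)
    then show ?thesis
      by (simp add: nn_integral_cmult measurable_semigroup_op t g mass)
  qed
  have "form (t + (t + t)) f g = (\<integral>\<^sup>+z. semigroup_op t f z * semigroup_op (t + t) g z \<partial>M)"
    using t by (intro form_add f g) auto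
  also have "\<dots> = (\<integral>\<^sup>+z. semigroup_op t f z * semigroup_op t (semigroup_op t g) z \<partial>M)"
    by (intro nn_integral_cong) (simp only: semigroup_op_add[OF t t _ g])
  also have "\<dots> \<le> (\<integral>\<^sup>+z. semigroup_op t f z * (c * form t g (\<lambda>_. 1)) \<partial>M)"
    by (intro nn_integral_mono mult_left_mono bound) auto
  also have "\<dots> = c * form t f (\<lambda>_. 1) * form t g (\<lambda>_. 1)"
    unfolding nn_integral_multc[OF measurable_semigroup_op[OF t f]] mass[OF f] by (simp only: mult_ac)
  finally show ?thesis .
qed

end

section \<open>Riemannian measures are sigma-finite\<close>

lemma continuous_on_volume_density:
  assumes "riemannian_metric A g" and "is_chart D c" and "c \<in> A"
  shows "continuous_on (fst c) (volume_density g c)"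
proof -
  have hom: "homeomorphism (fst c) (chart_image c) (snd c) (chart_inv c)"
    using assms(2) by (simp add: is_chart_def)
  have entry: "continuous_on (chart_image c) (\<lambda>z. g c (chart_inv c z) $ i $ j)" for i j
  proof -
    have "Ck_on 0 (\<lambda>z. g c (chart_inv c z) $ i $ j) (chart_image c)"
      using assms(1,3) unfolding riemannian_metric_def smooth_on_def by blast
    then show ?thesis
      by simp
  qed
  have "continuous_on (fst c) ((\<lambda>z. volume_density g c (chart_inv c z)) \<circ> snd c)"
  proof (rule continuous_on_compose)
    show "continuous_on (fst c) (snd c)"
      using hom by (simp add: homeomorphism_def)
    show "continuous_on (chart_image c) (\<lambda>z. volume_density g c (chart_inv c z))"
      unfolding volume_density_def det_def by (intro continuous_intros entry)
  qed
  then show ?thesis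
    by (rule continuous_on_eq) (use hom in \<open>auto simp: homeomorphism_def\<close>)
qed

text \<open>
  In a chart, the part where both the coordinates and the volume density are bounded by \<open>n\<close> has
  measure at most \<open>n\<close> times the volume of a Euclidean ball.  Countably many charts cover the
  manifold by the Lindelof property.
\<close>

lemma sigma_finite_riemannian_measure:
  fixes D :: "'a::{t2_space, second_countable_topology} set"
    and A :: "('a, 'n::finite) chart set"
  assumes man: "smooth_manifold D A" and metric: "riemannian_metric A g"
    and meas: "riemannian_measure D A g M"
  shows "sigma_finite_measure M"
proof -
  have sets_M: "sets M = sets (restrict_space borel D)"
    using meas by (simp add: riemannian_measure_def)
  then have space_M: "space M = D"
    using sets_eq_imp_space_eq[OF sets_M] by (simp add: space_restrict_space)
  have chart: "is_chart D c" if "c \<in> A" for c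
    using man that by (simp add: smooth_manifold_def)
  have "\<And>S. S \<in> fst ` A \<Longrightarrow> openin (top_of_set D) S"
    using chart by (auto simp: is_chart_def)
  then obtain \<U> where \<U>: "\<U> \<subseteq> fst ` A" "countable \<U>" "\<Union>\<U> = \<Union>(fst ` A)"
    by (rule Lindelof_openin)
  obtain C where C: "C \<subseteq> A" "countable C" "\<U> = fst ` C"
    using countable_subset_image[of \<U> fst A] \<U> by auto
  define B where
    "B c n = {x \<in> fst c. norm (snd c x) \<le> real n \<and> volume_density g c x \<le> real n}" for c n
  \<comment> \<open>D need not be a Borel set, so the pieces are only traces on D of Borel sets.\<close>
  have B_sets: "B c n \<in> sets M" if c: "c \<in> A" for c n
  proof -
    have "continuous_on (fst c) (snd c)"
      using chart[OF c] by (simp add: is_chart_def homeomorphism_def)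
    then have "continuous_on (fst c) (\<lambda>x. (norm (snd c x), volume_density g c x))"
      by (intro continuous_intros continuous_on_volume_density[OF metric chart[OF c] c])
    then have "closedin (top_of_set (fst c))
        (fst c \<inter> (\<lambda>x. (norm (snd c x), volume_density g c x)) -` ({..real n} \<times> {..real n}))"
      by (intro continuous_closedin_preimage closed_Times closed_atMost)
    also have "fst c \<inter> (\<lambda>x. (norm (snd c x), volume_density g c x)) -` ({..real n} \<times> {..real n}) = B c n"
      by (auto simp: B_def)
    finally obtain T where T: "closed T" "B c n = fst c \<inter> T"
      by (auto simp: closedin_closed)
    obtain U where U: "open U" "fst c = D \<inter> U"
      using chart[OF c] by (auto simp: is_chart_def openin_open)
    have "B c n = D \<inter> (U \<inter> T)" "U \<inter> T \<in> sets borel"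
      using T U by auto
    then show ?thesis
      by (auto simp: sets_M sets_restrict_space)
  qed
  have B_finite: "emeasure M (B c n) \<noteq> \<infinity>" if c: "c \<in> A" for c n
  proof -
    have inv: "chart_inv c (snd c x) = x" if "x \<in> fst c" for x
      using chart[OF c] that by (simp add: is_chart_def homeomorphism_def)
    have "emeasure M (B c n)
        = (\<integral>\<^sup>+z\<in>snd c ` B c n. ennreal (volume_density g c (chart_inv c z)) \<partial>lborel)"
      using meas c B_sets[OF c, of n] unfolding riemannian_measure_def by (auto simp: B_def)
    also have "\<dots> \<le> (\<integral>\<^sup>+z. ennreal (real n) * indicator (cball (0 :: real ^ 'n) (real n)) z \<partial>lborel)"
      by (intro nn_integral_mono) (auto simp: B_def inv ennreal_leI split: split_indicator)
    also have "\<dots> = ennreal (real n) * emeasure lborel (cball (0 :: real ^ 'n) (real n))"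
      by (simp add: nn_integral_cmult_indicator)
    also have "\<dots> < \<infinity>"
      by (simp add: ennreal_mult_less_top emeasure_bounded_finite[OF bounded_cball, unfolded infinity_ennreal_def])
    finally show ?thesis
      by simp
  qed
  show ?thesis
  proof
    show "\<exists>F. countable F \<and> F \<subseteq> sets M \<and> \<Union>F = space M \<and> (\<forall>a\<in>F. emeasure M a \<noteq> \<infinity>)"
    proof (intro exI conjI ballI)
      show "countable (\<Union>c\<in>C. range (B c))"
        using C by auto
      show "(\<Union>c\<in>C. range (B c)) \<subseteq> sets M"
        using B_sets C by auto
      show "\<Union>(\<Union>c\<in>C. range (B c)) = space M"
      proof -
        have "x \<in> (\<Union>n. B c n)" if "x \<in> fst c" for x c
        proof -
          obtain n where "max (norm (snd c x)) (volume_density g c x) \<le> real n"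
            using real_arch_simple by blast
          then show ?thesis
            using that by (auto simp: B_def)
        qed
        moreover have "B c n \<subseteq> fst c" for c n
          by (auto simp: B_def)
        ultimately have "(\<Union>n. B c n) = fst c" for c
          by blast
        then have "\<Union>(\<Union>c\<in>C. range (B c)) = \<Union>\<U>"
          unfolding C(3) by blast
        also have "\<dots> = space M"
          using \<U>(3) man space_M by (simp add: smooth_manifold_def)
        finally show ?thesis .
      qed
      show "emeasure M a \<noteq> \<infinity>" if "a \<in> (\<Union>c\<in>C. range (B c))" for a
        using that B_finite C by auto
    qed
  qed
qed

section \<open>Measurability of the heat kernel\<close>

text \<open>
  Joint smoothness is a condition on the coordinate expressions; continuity in each product of
  two charts is glued together over the open cover of \<open>D \<times> D\<close> by such products.
\<close>

lemma continuous_on_jointly_smooth: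
  assumes man: "smooth_manifold D A" and smooth: "jointly_smooth A p" and t: "t > 0"
  shows "continuous_on (D \<times> D) (\<lambda>(x, y). p x y t)"
proof -
  have chart: "is_chart D c" if "c \<in> A" for c
    using man that by (simp add: smooth_manifold_def)
  have local: "continuous_on (fst c \<times> fst c') (\<lambda>(x, y). p x y t)" if c: "c \<in> A" "c' \<in> A" for c c'
  proof -
    have "Ck_on 0 (\<lambda>(z, w, t). p (chart_inv c z) (chart_inv c' w) t)
        (chart_image c \<times> chart_image c' \<times> {0<..})"
      using smooth c unfolding jointly_smooth_def smooth_on_def by blast
    then have p: "continuous_on (chart_image c \<times> chart_image c' \<times> {0<..})
        (\<lambda>(z, w, t). p (chart_inv c z) (chart_inv c' w) t)"
      by simp
    have hom: "homeomorphism (fst d) (chart_image d) (snd d) (chart_inv d)" if "d \<in> A" for d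
      using chart[OF that] by (simp add: is_chart_def)
    have "continuous_on (fst c \<times> fst c') (\<lambda>q. (snd c (fst q), snd c' (snd q), t))"
      using hom[OF c(1)] hom[OF c(2)] unfolding homeomorphism_def
      by (intro continuous_intros) (auto intro: continuous_on_compose2[OF _ continuous_on_fst]
          continuous_on_compose2[OF _ continuous_on_snd] continuous_on_id)
    then have "continuous_on (fst c \<times> fst c')
        (\<lambda>q. (\<lambda>(z, w, t). p (chart_inv c z) (chart_inv c' w) t) (snd c (fst q), snd c' (snd q), t))"
      by (rule continuous_on_compose2[OF p]) (use t in auto)
    then show ?thesis
      by (rule continuous_on_eq)
        (use hom[OF c(1)] hom[OF c(2)] in \<open>auto simp: homeomorphism_def\<close>)
  qed
  have "continuous_map (top_of_set (D \<times> D)) euclidean (\<lambda>(x, y). p x y t)"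
  proof (rule pasting_lemma[where I = "A \<times> A" and T = "\<lambda>(c, c'). fst c \<times> fst c'" and f = "\<lambda>_ (x, y). p x y t"])
    fix i assume "i \<in> A \<times> A"
    then obtain c c' where i: "i = (c, c')" "c \<in> A" "c' \<in> A"
      by auto
    have op: "openin (top_of_set D) (fst c)" "openin (top_of_set D) (fst c')"
      using chart i by (auto simp: is_chart_def)
    then show "openin (top_of_set (D \<times> D)) (case i of (c, c') \<Rightarrow> fst c \<times> fst c')"
      by (simp add: i openin_Times)
    have "fst c \<times> fst c' \<subseteq> D \<times> D"
      using op by (auto dest: openin_imp_subset)
    then show "continuous_map (subtopology (top_of_set (D \<times> D)) (case i of (c, c') \<Rightarrow> fst c \<times> fst c'))
        euclidean (\<lambda>(x, y). p x y t)"
      using local[OF i(2,3)] by (simp add: i subtopology_subtopology Int_absorb1)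
  next
    fix q assume "q \<in> topspace (top_of_set (D \<times> D))"
    then show "\<exists>j. j \<in> A \<times> A \<and> q \<in> (case j of (c, c') \<Rightarrow> fst c \<times> fst c') \<and>
        (\<lambda>(x, y). p x y t) q = (\<lambda>(x, y). p x y t) q"
      using man by (fastforce simp: smooth_manifold_def)
  qed auto
  then show ?thesis
    by simp
qed

text \<open>
  Second countability makes the product of the Borel sigma-algebras the Borel sigma-algebra of
  the product, so continuity suffices for joint measurability.
\<close>

lemma borel_measurable_pair_restrict:
  fixes D :: "'a::second_countable_topology set" and h :: "'a \<times> 'a \<Rightarrow> 'b::topological_space"
  assumes sets_M: "sets M = sets (restrict_space borel D)" and h: "continuous_on (D \<times> D) h"
  shows "h \<in> borel_measurable (M \<Otimes>\<^sub>M M)"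
proof -
  have "space M = D"
    using sets_eq_imp_space_eq[OF sets_M] by (simp add: space_restrict_space)
  have "(\<lambda>x. x) \<in> M \<rightarrow>\<^sub>M borel"
    unfolding measurable_cong_sets[OF sets_M refl] by (simp add: measurable_restrict_space1)
  then have "(\<lambda>q. (fst q, snd q)) \<in> M \<Otimes>\<^sub>M M \<rightarrow>\<^sub>M borel \<Otimes>\<^sub>M borel"
    by (intro measurable_Pair) (auto intro: measurable_compose[OF measurable_fst] measurable_compose[OF measurable_snd])
  then have "(\<lambda>q. q) \<in> M \<Otimes>\<^sub>M M \<rightarrow>\<^sub>M restrict_space borel (D \<times> D)"
    using \<open>space M = D\<close> by (intro measurable_restrict_space2) (auto simp: space_pair_measure borel_prod)
  then show ?thesis
    using measurable_compose[OF _ borel_measurable_continuous_on_restrict[OF h]] by blast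
qed

section \<open>Comparison of heat contents\<close>

theorem theorem1:
  fixes D :: "'a::{t2_space, second_countable_topology} set"
    and A :: "('a, 'n::finite) chart set"
    and g :: "('a, 'n) metric_tensor"
    and M :: "'a measure"
    and p :: "'a \<Rightarrow> 'a \<Rightarrow> real \<Rightarrow> real"
    and \<psi>\<^sub>1 \<psi>\<^sub>2 :: "'a \<Rightarrow> real"
  assumes "smooth_manifold D A" and "connected D" and "riemannian_metric A g"
    and "riemannian_measure D A g M"
    and "dirichlet_heat_kernel D A g M p"
    and "\<And>x y t. x \<in> D \<Longrightarrow> y \<in> D \<Longrightarrow> t > 0 \<Longrightarrow> p x y t = p y x t"
    and "\<And>x y t. x \<in> D \<Longrightarrow> y \<in> D \<Longrightarrow> t > 0 \<Longrightarrow> p x y t > 0"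
    and "jointly_smooth A p"
    and "\<And>x y s t. x \<in> D \<Longrightarrow> y \<in> D \<Longrightarrow> s > 0 \<Longrightarrow> t > 0 \<Longrightarrow>
           ennreal (p x y (s + t)) = (\<integral>\<^sup>+z. ennreal (p x z s * p z y t) \<partial>M)"
    and "\<psi>\<^sub>1 \<in> borel_measurable (restrict_space borel D)" and "\<And>x. x \<in> D \<Longrightarrow> \<psi>\<^sub>1 x \<ge> 0"
    and "\<psi>\<^sub>2 \<in> borel_measurable (restrict_space borel D)" and "\<And>x. x \<in> D \<Longrightarrow> \<psi>\<^sub>2 x \<ge> 0"
  shows
    "((\<forall>t>0. heat_content M p \<psi>\<^sub>1 \<psi>\<^sub>1 t < \<infinity>) \<and> (\<forall>t>0. heat_content M p \<psi>\<^sub>2 \<psi>\<^sub>2 t < \<infinity>) \<longrightarrow>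
       (\<forall>t>0. heat_content M p \<psi>\<^sub>1 \<psi>\<^sub>2 t < \<infinity> \<and>
          enn2real (heat_content M p \<psi>\<^sub>1 \<psi>\<^sub>2 t) \<le>
            sqrt (enn2real (heat_content M p \<psi>\<^sub>1 \<psi>\<^sub>1 t) * enn2real (heat_content M p \<psi>\<^sub>2 \<psi>\<^sub>2 t)))) \<and>
     ((\<forall>t>0. heat_content M p \<psi>\<^sub>1 (\<lambda>_. 1) t < \<infinity>) \<and> (\<forall>t>0. heat_content M p \<psi>\<^sub>2 (\<lambda>_. 1) t < \<infinity>) \<and>
      (\<forall>t>0. diagonal_sup D p t < \<infinity>) \<longrightarrow>
       (\<forall>t>0. heat_content M p \<psi>\<^sub>1 \<psi>\<^sub>2 t \<le>
            diagonal_sup D p (t / 3) * heat_content M p \<psi>\<^sub>1 (\<lambda>_. 1) (t / 3)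
              * heat_content M p \<psi>\<^sub>2 (\<lambda>_. 1) (t / 3) \<and>
          diagonal_sup D p (t / 3) * heat_content M p \<psi>\<^sub>1 (\<lambda>_. 1) (t / 3)
              * heat_content M p \<psi>\<^sub>2 (\<lambda>_. 1) (t / 3) < \<infinity>))"
proof -
  note sym = assms(6) and pos = assms(7) and semigroup = assms(9)
  note nonneg\<^sub>1 = assms(11) and nonneg\<^sub>2 = assms(13)
  have sets_M: "sets M = sets (restrict_space borel D)"
    using assms(4) by (simp add: riemannian_measure_def)
  have space_M: "space M = D"
    using sets_eq_imp_space_eq[OF sets_M] by (simp add: space_restrict_space)
  define k where "k t x y = ennreal (p x y t)" for t x y
  interpret sigma_finite_measure M
    by (rule sigma_finite_riemannian_measure[OF assms(1,3,4)])
  interpret symmetric_kernel_semigroup M k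
  proof
    show "(\<lambda>(x, y). k t x y) \<in> borel_measurable (M \<Otimes>\<^sub>M M)" if "t > 0" for t
      using measurable_compose[OF borel_measurable_pair_restrict[OF sets_M
            continuous_on_jointly_smooth[OF assms(1,8) that]] measurable_ennreal]
      by (simp add: k_def case_prod_unfold)
    show "k t x y = k t y x" if "x \<in> space M" "y \<in> space M" "t > 0" for t x y
      using that sym by (simp add: k_def space_M)
    show "k (s + t) x y = (\<integral>\<^sup>+z. k s x z * k t z y \<partial>M)"
      if "x \<in> space M" "y \<in> space M" "s > 0" "t > 0" for s t x y
      using that unfolding k_def space_M
      by (auto simp: semigroup space_M pos less_imp_le ennreal_mult intro!: nn_integral_cong)
  qed
  have heat: "heat_content M p f h t = form t (\<lambda>x. ennreal (f x)) (\<lambda>x. ennreal (h x))"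
    if t: "t > 0" and [measurable]: "f \<in> borel_measurable M" "h \<in> borel_measurable M"
      and "\<And>x. x \<in> D \<Longrightarrow> f x \<ge> 0" "\<And>x. x \<in> D \<Longrightarrow> h x \<ge> 0" for f h t
  proof -
    note [measurable (raw)] = measurable_kernel_compose[OF t]
    have "heat_content M p f h t
        = (\<integral>\<^sup>+q. ennreal (f (fst q)) * (k t (fst q) (snd q) * ennreal (h (snd q))) \<partial>(M \<Otimes>\<^sub>M M))"
      unfolding heat_content_def k_def using that pos
      by (intro nn_integral_cong)
        (auto simp: space_pair_measure space_M less_imp_le ennreal_mult mult_ac)
    also have "\<dots> = (\<integral>\<^sup>+x. \<integral>\<^sup>+y. ennreal (f x) * (k t x y * ennreal (h y)) \<partial>M \<partial>M)"
      by (subst nn_integral_fst[symmetric]) auto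
    also have "\<dots> = form t (\<lambda>x. ennreal (f x)) (\<lambda>x. ennreal (h x))"
      unfolding form_def semigroup_op_def by (intro nn_integral_cong nn_integral_cmult) measurable
    finally show ?thesis .
  qed
  have meas [measurable]: "\<psi>\<^sub>1 \<in> borel_measurable M" "\<psi>\<^sub>2 \<in> borel_measurable M"
    using assms(10,12) by (simp_all add: measurable_cong_sets[OF sets_M refl])
  define f\<^sub>1 f\<^sub>2 where "f\<^sub>1 = (\<lambda>x. ennreal (\<psi>\<^sub>1 x))" and "f\<^sub>2 = (\<lambda>x. ennreal (\<psi>\<^sub>2 x))"
  have f: "f\<^sub>1 \<in> borel_measurable M" "f\<^sub>2 \<in> borel_measurable M"
    unfolding f\<^sub>1_def f\<^sub>2_def by measurable
  have heat_form:
    "heat_content M p \<psi>\<^sub>1 \<psi>\<^sub>1 t = form t f\<^sub>1 f\<^sub>1" "heat_content M p \<psi>\<^sub>2 \<psi>\<^sub>2 t = form t f\<^sub>2 f\<^sub>2"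
    "heat_content M p \<psi>\<^sub>1 \<psi>\<^sub>2 t = form t f\<^sub>1 f\<^sub>2"
    "heat_content M p \<psi>\<^sub>1 (\<lambda>_. 1) t = form t f\<^sub>1 (\<lambda>_. 1)"
    "heat_content M p \<psi>\<^sub>2 (\<lambda>_. 1) t = form t f\<^sub>2 (\<lambda>_. 1)" if "t > 0" for t
    using that by (simp_all add: heat nonneg\<^sub>1 nonneg\<^sub>2 meas f\<^sub>1_def f\<^sub>2_def)
  have part1: "heat_content M p \<psi>\<^sub>1 \<psi>\<^sub>2 t < \<infinity> \<and>
      enn2real (heat_content M p \<psi>\<^sub>1 \<psi>\<^sub>2 t) \<le>
        sqrt (enn2real (heat_content M p \<psi>\<^sub>1 \<psi>\<^sub>1 t) * enn2real (heat_content M p \<psi>\<^sub>2 \<psi>\<^sub>2 t))"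
    if fin: "heat_content M p \<psi>\<^sub>1 \<psi>\<^sub>1 t < \<infinity>" "heat_content M p \<psi>\<^sub>2 \<psi>\<^sub>2 t < \<infinity>" and t: "t > 0" for t
  proof -
    have le: "(form t f\<^sub>1 f\<^sub>2)\<^sup>2 \<le> form t f\<^sub>1 f\<^sub>1 * form t f\<^sub>2 f\<^sub>2"
      by (rule form_Cauchy_Schwarz[OF t f])
    have prod_fin: "form t f\<^sub>1 f\<^sub>1 * form t f\<^sub>2 f\<^sub>2 < top"
      using fin by (simp add: heat_form t ennreal_mult_less_top)
    have "(form t f\<^sub>1 f\<^sub>2)\<^sup>2 < top"
      using le prod_fin by (rule le_less_trans)
    then have "form t f\<^sub>1 f\<^sub>2 < top"
      by (simp add: power_less_top_ennreal)
    moreover have "(enn2real (form t f\<^sub>1 f\<^sub>2))\<^sup>2 \<le> enn2real (form t f\<^sub>1 f\<^sub>1) * enn2real (form t f\<^sub>2 f\<^sub>2)"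
      using enn2real_mono[OF le prod_fin] by (simp add: power2_eq_square enn2real_mult)
    ultimately show ?thesis
      by (simp add: heat_form t real_le_rsqrt)
  qed
  have part2: "heat_content M p \<psi>\<^sub>1 \<psi>\<^sub>2 t \<le>
      diagonal_sup D p (t / 3) * heat_content M p \<psi>\<^sub>1 (\<lambda>_. 1) (t / 3) * heat_content M p \<psi>\<^sub>2 (\<lambda>_. 1) (t / 3)"
    if t: "t > 0" for t
  proof -
    have diag: "k (t / 3) z z \<le> diagonal_sup D p (t / 3)" if "z \<in> space M" for z
      unfolding diagonal_sup_def k_def using that by (intro SUP_upper) (simp add: space_M)
    have t3: "t / 3 > 0" "t / 3 + (t / 3 + t / 3) = t"
      using t by auto
    show ?thesis
      using form_le_of_diagonal[OF t3(1) f diag] by (simp add: heat_form t t3)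
  qed
  show ?thesis
    using part1 part2 by (auto simp: ennreal_mult_less_top)
qed

end
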